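(* The Friedrichs operator of the pentablock $$\mathcal{P}=\{(a_{21},\operatorname{tr}(A),\det A)\in\mathbb{C}^3 : A=[a_{ij}]\in\mathbb{C}^{2\times 2},\ \|A\|<1\}$$ is of rank one.
   Context: $\|A\|$ denotes the operator norm of the matrix $A$. For a domain $D\subset\mathbb{C}^n$, the Bergman space $A^2(D)$ is the closed subspace of $L^2(D)$ (with respect to Lebesgue measure, with inner product $\langle f,g\rangle=\int_D f\bar g\,dV$) consisting of holomorphic functions. The Bergman projection $B_D$ is the orthogonal projection of $L^2(D)$ onto $A^2(D)$. The Friedrichs operator of $D$ is the (conjugate-linear) map $F_D\colon A^2(D)\to A^2(D)$, $F_D(g)=B_D(\bar g)$. It is of rank one if its range is a one-dimensional complex vector space. *)

theory Defs
  imports "HOL-Analysis.Analysis" "HOL-Library.Function_Algebras"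
begin

text \<open>Holomorphy in several variables: the real Frechet derivative exists and is complex linear.
  For open \<open>D\<close> this only depends on the values of \<open>f\<close> on \<open>D\<close>.\<close>

definition holomorphic_sev_on :: "(complex^'n \<Rightarrow> complex) \<Rightarrow> (complex^'n) set \<Rightarrow> bool" where
  "holomorphic_sev_on f D \<longleftrightarrow>
     (\<forall>z\<in>D. \<exists>f'. (f has_derivative f') (at z) \<and> (\<forall>c v. f' (c *s v) = c * f' v))"

definition square_integrable_on :: "(complex^'n \<Rightarrow> complex) \<Rightarrow> (complex^'n) set \<Rightarrow> bool" where
  "square_integrable_on f D \<longleftrightarrow>
     f \<in> borel_measurable (lebesgue_on D) \<and> integrable (lebesgue_on D) (\<lambda>z. (cmod (f z))\<^sup>2)"

definition L2_inner :: "(complex^'n) set \<Rightarrow> (complex^'n \<Rightarrow> complex) \<Rightarrow> (complex^'n \<Rightarrow> complex) \<Rightarrow> complex" where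
  "L2_inner D f g = (LINT z|lebesgue_on D. f z * cnj (g z))"

text \<open>A function on \<open>D\<close> is represented by its extension by zero to the whole space, so that
  equality of elements of the Bergman space is equality of functions, and its vector space
  operations are the pointwise ones.\<close>

definition bergman_space :: "(complex^'n) set \<Rightarrow> (complex^'n \<Rightarrow> complex) set" where
  "bergman_space D =
     {f. holomorphic_sev_on f D \<and> square_integrable_on f D \<and> (\<forall>z. z \<notin> D \<longrightarrow> f z = 0)}"

text \<open>The orthogonal projection of \<open>f\<close> is the element \<open>g\<close> of the closed subspace such that
  \<open>f - g\<close> is orthogonal to the subspace; it is meaningful for \<open>f\<close> square-integrable on
  an open set \<open>D\<close>.\<close>

definition bergman_projection :: "(complex^'n) set \<Rightarrow> (complex^'n \<Rightarrow> complex) \<Rightarrow> (complex^'n \<Rightarrow> complex)" where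
  "bergman_projection D f =
     (THE g. g \<in> bergman_space D \<and> (\<forall>h\<in>bergman_space D. L2_inner D (\<lambda>z. f z - g z) h = 0))"

definition friedrichs :: "(complex^'n) set \<Rightarrow> (complex^'n \<Rightarrow> complex) \<Rightarrow> (complex^'n \<Rightarrow> complex)" where
  "friedrichs D g = bergman_projection D (\<lambda>z. cnj (g z))"

definition cfun_scale :: "complex \<Rightarrow> ('a \<Rightarrow> complex) \<Rightarrow> ('a \<Rightarrow> complex)" where
  "cfun_scale c f = (\<lambda>z. c * f z)"

interpretation cfun: vector_space "cfun_scale :: complex \<Rightarrow> ('a \<Rightarrow> complex) \<Rightarrow> ('a \<Rightarrow> complex)"
  by unfold_locales (auto simp: cfun_scale_def fun_eq_iff algebra_simps)

definition friedrichs_rank_one :: "(complex^'n) set \<Rightarrow> bool" where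
  "friedrichs_rank_one D \<longleftrightarrow>
     cfun.subspace (friedrichs D ` bergman_space D) \<and> cfun.dim (friedrichs D ` bergman_space D) = 1"

text \<open>The norm on \<^typ>\<open>complex^2\<close> is the Euclidean one, so \<^const>\<open>onorm\<close> is the
  operator norm of the matrix.\<close>

definition pentablock :: "(complex^3) set" where
  "pentablock = {vector [A $ 2 $ 1, trace A, det A] | A :: complex^2^2. onorm (\<lambda>v. A *v v) < 1}"

end

theory Submission
  imports Defs "HOL-Complex_Analysis.Cauchy_Integral_Formula"
begin

text \<open>
  Multiplying a matrix \<open>A\<close> by a scalar \<open>c\<close> with \<open>\<bar>c\<bar> \<le> 1\<close> keeps its operator norm below 1 and sends
  \<open>(a\<^sub>2\<^sub>1, tr A, det A)\<close> to \<open>(c a\<^sub>2\<^sub>1, c tr A, c\<^sup>2 det A)\<close>. So the pentablock is quasi-balanced: it is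
  mapped into itself by the weighted dilations with weights \<open>(1, 1, 2)\<close>. This is the only
  feature of the pentablock that matters, besides its being open, nonempty and bounded.

  Let \<open>D\<close> be any such domain, with positive weights, and \<open>f\<close> holomorphic and integrable on \<open>D\<close>.
  For \<open>\<bar>c\<bar> = 1\<close> the dilation by \<open>c\<close> is a linear isometry that permutes \<open>D\<close>, so it leaves the
  integral of \<open>f\<close> unchanged. Averaging over the unit circle and exchanging the integrals, one
  has to average \<open>f\<close> over each orbit of the circle in \<open>D\<close>. Each orbit bounds a holomorphic disc
  in \<open>D\<close>, centred at the origin, so by Cauchy's formula this average is \<open>f 0\<close>. Hence \<open>D\<close> is a
  quadrature domain for the point mass at the origin: \<open>\<integral>\<^sub>D f = vol D \<cdot> f 0\<close>
  (\<open>integral_holomorphic_quasi_balanced\<close>).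

  For \<open>g\<close> and \<open>h\<close> in the Bergman space the inner product of \<open>cnj g\<close> with \<open>h\<close> is the conjugate of
  the integral of \<open>g h\<close>, that is, of \<open>vol D \<cdot> g 0 \<cdot> h 0\<close>. The constant function \<open>cnj (g 0)\<close> has the
  same inner product with \<open>h\<close>, so it is the projection of \<open>cnj g\<close>
  (\<open>friedrichs_quasi_balanced\<close>). The range of the Friedrichs operator therefore consists of the
  constants, and it is one-dimensional.
\<close>

section \<open>Lebesgue measure is invariant under linear isometries\<close>

lemma nn_integral_lborel_translate:
  fixes f :: "'a::euclidean_space \<Rightarrow> ennreal"
  assumes [measurable]: "f \<in> borel_measurable borel"
  shows "(\<integral>\<^sup>+x. f (c + x) \<partial>lborel) = (\<integral>\<^sup>+x. f x \<partial>lborel)"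
proof -
  have "(\<integral>\<^sup>+x. f x \<partial>lborel) = (\<integral>\<^sup>+x. f x \<partial>distr lborel borel ((+) c))"
    by (simp only: lborel_distr_plus)
  then show ?thesis by (simp add: nn_integral_distr)
qed

lemma nn_integral_lborel_reflect:
  fixes f :: "'a::euclidean_space \<Rightarrow> ennreal"
  assumes [measurable]: "f \<in> borel_measurable borel"
  shows "(\<integral>\<^sup>+x. f (c - x) \<partial>lborel) = (\<integral>\<^sup>+x. f x \<partial>lborel)"
proof -
  have "distr lborel borel (\<lambda>x::'a. c - x) = lborel"
    using lborel_affine[of "-1" c] by (simp add: density_1)
  then have "(\<integral>\<^sup>+x. f x \<partial>lborel) = (\<integral>\<^sup>+x. f x \<partial>distr lborel borel (\<lambda>x. c - x))"
    by simp
  then show ?thesis by (simp add: nn_integral_distr)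
qed

text \<open>The uniqueness argument for Haar measure. Integrate \<open>1\<^sub>A (T x) 1\<^sub>B y\<close> over all \<open>x\<close> and \<open>y\<close>,
  where \<open>B\<close> is the unit ball. Translations in \<open>y\<close> and in \<open>x\<close> turn the integrand into
  \<open>1\<^sub>A (T x - y) 1\<^sub>B (T x)\<close>, which separates again after a reflection in \<open>y\<close>. Since \<open>T\<close> preserves \<open>B\<close>,
  a set of finite positive measure, the factor that belongs to \<open>B\<close> cancels.\<close>

lemma lborel_distr_orthogonal:
  fixes T :: "'a::euclidean_space \<Rightarrow> 'a"
  assumes T: "orthogonal_transformation T"
  shows "distr lborel borel T = lborel"
proof (rule measure_eqI)
  have lin: "linear T" using T by (rule orthogonal_transformation_linear)
  have cont: "continuous_on UNIV T"
    using lin by (simp add: linear_continuous_on linear_linear)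
  have mT[measurable]: "T \<in> borel_measurable borel"
    using cont by (rule borel_measurable_continuous_onI)
  fix A :: "'a set" assume "A \<in> sets (distr lborel borel T)"
  then have A[measurable]: "A \<in> sets borel" by simp
  let ?B = "ball (0::'a) 1"
  have TB: "T x \<in> ?B \<longleftrightarrow> x \<in> ?B" for x
    using orthogonal_transformation_norm[OF T] by simp
  have "surj T" using T by (rule orthogonal_transformation_surj)
  define a b :: "'a \<Rightarrow> ennreal" where "a = indicator A" and "b = indicator ?B"
  have [measurable]: "a \<in> borel_measurable borel" "b \<in> borel_measurable borel"
    unfolding a_def b_def by (intro borel_measurable_indicator borel_open A open_ball)+
  have "(\<integral>\<^sup>+x. a (T x) \<partial>lborel) * (\<integral>\<^sup>+y. b y \<partial>lborel)
      = (\<integral>\<^sup>+x. \<integral>\<^sup>+y. a (T x) * b y \<partial>lborel \<partial>lborel)"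
    by (simp add: nn_integral_cmult nn_integral_multc)
  also have "\<dots> = (\<integral>\<^sup>+x. \<integral>\<^sup>+y. a (T x) * b (T x + y) \<partial>lborel \<partial>lborel)"
    by (subst nn_integral_lborel_translate[where f="\<lambda>y. a (T _) * b y"]) auto
  also have "\<dots> = (\<integral>\<^sup>+y. \<integral>\<^sup>+x. a (T x) * b (T x + y) \<partial>lborel \<partial>lborel)"
    by (rule lborel_pair.Fubini') simp
  also have "\<dots> = (\<integral>\<^sup>+y. \<integral>\<^sup>+x. a (T x - y) * b (T x) \<partial>lborel \<partial>lborel)"
  proof (rule nn_integral_cong)
    fix y
    \<comment> \<open>As \<open>T\<close> is onto, translating \<open>T x\<close> by \<open>y\<close> amounts to translating \<open>x\<close>.\<close>
    obtain u where u: "y = T u" using \<open>surj T\<close> by blast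
    have "(\<integral>\<^sup>+x. a (T x) * b (T x + y) \<partial>lborel)
        = (\<integral>\<^sup>+x. a (T (- u + x)) * b (T (- u + x) + y) \<partial>lborel)"
      by (rule nn_integral_lborel_translate[symmetric]) measurable
    then show "(\<integral>\<^sup>+x. a (T x) * b (T x + y) \<partial>lborel)
        = (\<integral>\<^sup>+x. a (T x - y) * b (T x) \<partial>lborel)"
      by (simp add: u linear_add[OF lin] linear_neg[OF lin] linear_diff[OF lin])
  qed
  also have "\<dots> = (\<integral>\<^sup>+x. \<integral>\<^sup>+y. a (T x - y) * b (T x) \<partial>lborel \<partial>lborel)"
    by (rule lborel_pair.Fubini') simp
  also have "\<dots> = (\<integral>\<^sup>+x. \<integral>\<^sup>+y. a y * b (T x) \<partial>lborel \<partial>lborel)"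
    by (intro nn_integral_cong nn_integral_lborel_reflect[where f="\<lambda>y. a y * b (T _)"]) auto
  also have "\<dots> = emeasure lborel A * emeasure lborel ?B"
  proof -
    have "b (T x) = b x" for x using TB[of x] by (auto simp: b_def indicator_def)
    then have "(\<integral>\<^sup>+x. \<integral>\<^sup>+y. a y * b (T x) \<partial>lborel \<partial>lborel)
        = (\<integral>\<^sup>+y. a y \<partial>lborel) * (\<integral>\<^sup>+x. b x \<partial>lborel)"
      by (simp add: nn_integral_cmult nn_integral_multc)
    then show ?thesis by (simp add: a_def b_def)
  qed
  finally have *: "(\<integral>\<^sup>+x. indicator A (T x) \<partial>lborel) * emeasure lborel ?B
     = emeasure lborel A * emeasure lborel ?B" by (simp add: a_def b_def)
  have "emeasure lborel ?B \<noteq> 0"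
    using open_not_negligible[of ?B] by (auto simp: negligible_iff_emeasure0)
  moreover have "emeasure lborel ?B \<noteq> top" using emeasure_lborel_ball_finite[of "0::'a" 1] by auto
  ultimately have "(\<integral>\<^sup>+x. indicator A (T x) \<partial>lborel) = emeasure lborel A"
    using * by (metis ennreal_mult_divide_eq infinity_ennreal_def)
  moreover have "(\<integral>\<^sup>+x. indicator A x \<partial>distr lborel borel T) = (\<integral>\<^sup>+x. indicator A (T x) \<partial>lborel)"
    by (rule nn_integral_distr) auto
  ultimately show "emeasure (distr lborel borel T) A = emeasure lborel A"
    by simp
qed simp

section \<open>Weighted dilations and holomorphic functions\<close>

lemma has_integral_circle_mean:
  assumes "f holomorphic_on cball 0 1"
  shows "((\<lambda>t. f (exp (2 * of_real pi * \<i> * of_real t))) has_integral f 0) {0..1}"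
proof -
  have "((\<lambda>u. f u / (u - 0)) has_contour_integral (2 * of_real pi * \<i> * f 0)) (circlepath 0 1)"
    by (rule Cauchy_integral_circlepath_simple[OF assms]) simp
  then have "((\<lambda>t. f (exp (2 * of_real pi * \<i> * of_real t)) / exp (2 * of_real pi * \<i> * of_real t)
      * (2 * pi * \<i> * exp (2 * of_real pi * \<i> * of_real t))) has_integral 2 * of_real pi * \<i> * f 0) {0..1}"
    unfolding has_contour_integral vector_derivative_circlepath by (simp add: circlepath)
  then have "((\<lambda>t. 2 * of_real pi * \<i> * f (exp (2 * of_real pi * \<i> * of_real t)))
      has_integral 2 * of_real pi * \<i> * f 0) {0..1}"
    by (simp add: field_simps)
  from has_integral_mult_right[OF this, of "1 / (2 * of_real pi * \<i>)"] show ?thesis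
    by (simp add: field_simps)
qed

definition weighted_dilation :: "('n \<Rightarrow> nat) \<Rightarrow> complex \<Rightarrow> complex^'n \<Rightarrow> complex^'n" where
  "weighted_dilation m c z = (\<chi> i. c ^ m i * z $ i)"

lemma orthogonal_weighted_dilation:
  assumes "cmod c = 1"
  shows "orthogonal_transformation (weighted_dilation m c)"
proof -
  have "linear (weighted_dilation m c)"
    by (rule linearI) (simp_all add: weighted_dilation_def vec_eq_iff algebra_simps)
  moreover have "norm (weighted_dilation m c z) = norm z" for z
    by (simp add: weighted_dilation_def norm_vec_def norm_mult norm_power assms)
  ultimately show ?thesis by (simp add: orthogonal_transformation)
qed

lemma weighted_dilation_compose:
  "weighted_dilation m c (weighted_dilation m d z) = weighted_dilation m (c * d) z"
  by (simp add: weighted_dilation_def vec_eq_iff power_mult_distrib)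

lemma weighted_dilation_1 [simp]: "weighted_dilation m 1 z = z"
  by (simp add: weighted_dilation_def vec_eq_iff)

lemma weighted_dilation_0: "(\<And>i. m i > 0) \<Longrightarrow> weighted_dilation m 0 z = 0"
  by (simp add: weighted_dilation_def vec_eq_iff)

lemma continuous_on_weighted_dilation [continuous_intros]:
  assumes "continuous_on S c" "continuous_on S z"
  shows "continuous_on S (\<lambda>x. weighted_dilation m (c x) (z x))"
  unfolding weighted_dilation_def by (intro continuous_intros assms continuous_on_vec_lambda)

text \<open>The curve \<open>c \<mapsto> weighted_dilation m c z\<close> has polynomial components, with derivative \<open>v\<close> say,
  and the differential of \<open>f\<close> is complex linear; so \<open>h \<mapsto> f' (h *s v)\<close> is multiplication by \<open>f' v\<close>.\<close>

lemma holomorphic_on_weighted_dilation: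
  fixes f :: "complex^'n \<Rightarrow> complex"
  assumes f: "holomorphic_sev_on f D" and S: "\<And>c. c \<in> S \<Longrightarrow> weighted_dilation m c z \<in> D"
  shows "(\<lambda>c. f (weighted_dilation m c z)) holomorphic_on S"
  unfolding holomorphic_on_def
proof
  fix c assume "c \<in> S"
  then obtain f' where f': "(f has_derivative f') (at (weighted_dilation m c z))"
    and lin: "\<And>a v. f' (a *s v) = a * f' v"
    using f S unfolding holomorphic_sev_on_def by blast
  define v where "v = (\<chi> i. of_nat (m i) * c ^ (m i - 1) * z $ i)"
  have pow: "((\<lambda>c. c ^ m i * z $ i) has_derivative (\<lambda>h. h * v $ i)) (at c)" for i
  proof -
    have "((\<lambda>c. c ^ m i * z $ i) has_field_derivative v $ i) (at c)"
      by (auto intro!: derivative_eq_intros simp: v_def)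
    then show ?thesis by (simp add: has_field_derivative_def mult.commute[of _ "v $ i"])
  qed
  have "((\<lambda>c. weighted_dilation m c z) has_derivative (\<lambda>h. h *s v)) (at c)"
    by (subst has_derivative_componentwise_within)
      (auto simp: weighted_dilation_def Basis_vec_def inner_axis pow intro!: has_derivative_inner_left)
  from has_derivative_compose[OF this f']
  have "((\<lambda>c. f (weighted_dilation m c z)) has_derivative (\<lambda>h. f' (h *s v))) (at c)" .
  then have "((\<lambda>c. f (weighted_dilation m c z)) has_field_derivative f' v) (at c)"
    by (simp add: has_field_derivative_def lin mult.commute[of _ "f' v"])
  then show "(\<lambda>c. f (weighted_dilation m c z)) field_differentiable at c within S"
    using field_differentiable_at_within field_differentiable_def by blast
qed

lemma holomorphic_sev_imp_continuous_on: "holomorphic_sev_on f D \<Longrightarrow> continuous_on D f"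
  unfolding holomorphic_sev_on_def
  by (meson continuous_at_imp_continuous_on has_derivative_continuous)

lemma holomorphic_sev_imp_borel:
  assumes "open D" "holomorphic_sev_on f D" "\<And>z. z \<notin> D \<Longrightarrow> f z = 0"
  shows "f \<in> borel_measurable borel"
proof -
  have "(\<lambda>z. indicator D z *\<^sub>R f z) \<in> borel_measurable borel"
    using assms by (intro borel_measurable_continuous_on_indicator holomorphic_sev_imp_continuous_on) auto
  also have "(\<lambda>z. indicator D z *\<^sub>R f z) = f" using assms(3) by (auto simp: indicator_def)
  finally show ?thesis .
qed

lemma holomorphic_sev_on_const_indicator:
  assumes "open D"
  shows "holomorphic_sev_on (\<lambda>z. if z \<in> D then k else 0) D"
  unfolding holomorphic_sev_on_def
proof (intro ballI exI conjI allI)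
  fix z assume "z \<in> D"
  show "((\<lambda>z. if z \<in> D then k else 0) has_derivative (\<lambda>_. 0)) (at z)"
    by (rule has_derivative_transform_within_open[OF has_derivative_const[of k] \<open>open D\<close> \<open>z \<in> D\<close>]) simp
qed simp

lemma holomorphic_sev_on_diff:
  assumes "holomorphic_sev_on f D" "holomorphic_sev_on g D"
  shows "holomorphic_sev_on (\<lambda>z. f z - g z) D"
  unfolding holomorphic_sev_on_def
proof
  fix z assume "z \<in> D"
  then obtain f' g' where "(f has_derivative f') (at z)" "(g has_derivative g') (at z)"
    "\<And>c v. f' (c *s v) = c * f' v" "\<And>c v. g' (c *s v) = c * g' v"
    using assms unfolding holomorphic_sev_on_def by metis
  then show "\<exists>h'. ((\<lambda>z. f z - g z) has_derivative h') (at z) \<and> (\<forall>c v. h' (c *s v) = c * h' v)"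
    by (intro exI[of _ "\<lambda>v. f' v - g' v"]) (auto intro!: has_derivative_diff simp: algebra_simps)
qed

lemma holomorphic_sev_on_mult:
  assumes "holomorphic_sev_on f D" "holomorphic_sev_on g D"
  shows "holomorphic_sev_on (\<lambda>z. f z * g z) D"
  unfolding holomorphic_sev_on_def
proof
  fix z assume "z \<in> D"
  then obtain f' g' where "(f has_derivative f') (at z)" "(g has_derivative g') (at z)"
    "\<And>c v. f' (c *s v) = c * f' v" "\<And>c v. g' (c *s v) = c * g' v"
    using assms unfolding holomorphic_sev_on_def by metis
  then show "\<exists>h'. ((\<lambda>z. f z * g z) has_derivative h') (at z) \<and> (\<forall>c v. h' (c *s v) = c * h' v)"
    by (intro exI[of _ "\<lambda>v. f z * g' v + f' v * g z"]) (auto intro!: has_derivative_mult simp: algebra_simps)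
qed

section \<open>The mean value property of quasi-balanced domains\<close>

text \<open>The orbit of \<open>z\<close> under the unit circle bounds the disc of all \<open>weighted_dilation m c z\<close> with
  \<open>cmod c \<le> 1\<close>. This disc lies in \<open>D\<close>, and because the weights are positive, its centre is the origin,
  whatever \<open>z\<close> is. So all orbits have the same mean \<open>f 0\<close>.\<close>

lemma integral_holomorphic_quasi_balanced:
  fixes f :: "complex^'n \<Rightarrow> complex"
  assumes D: "open D" "emeasure lborel D < \<infinity>"
    and bal: "\<And>c z. z \<in> D \<Longrightarrow> cmod c \<le> 1 \<Longrightarrow> weighted_dilation m c z \<in> D"
    and m: "\<And>i. m i > 0"
    and f: "holomorphic_sev_on f D" "\<And>z. z \<notin> D \<Longrightarrow> f z = 0" "integrable lborel f"
  shows "(\<integral>z. f z \<partial>lborel) = measure lborel D * f 0"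
proof -
  define e where "e t = exp (2 * of_real pi * \<i> * of_real t)" for t :: real
  have e1: "cmod (e t) = 1" for t
    by (simp add: e_def norm_exp_eq_Re)
  have e_cont: "continuous_on S e" for S
    unfolding e_def by (intro continuous_intros)
  let ?T = "\<lambda>t. weighted_dilation m (e t)"
  have [measurable]: "f \<in> borel_measurable borel"
    by (rule holomorphic_sev_imp_borel[OF D(1) f(1) f(2)])
  have Tm: "?T t \<in> borel_measurable borel" for t
    by (intro borel_measurable_continuous_onI continuous_intros)
  have [measurable]: "(\<lambda>p. ?T (fst p) (snd p)) \<in> borel_measurable (borel \<Otimes>\<^sub>M borel)"
    unfolding borel_prod
    by (intro borel_measurable_continuous_onI continuous_intros continuous_on_compose2[OF e_cont[of UNIV]]) auto
  \<comment> \<open>The circle is parametrized by the unit interval, so that its total mass is 1.\<close>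
  define F where "F t z = indicator {0..1} t *\<^sub>R f (?T t z)" for t z
  have [measurable]: "case_prod F \<in> borel_measurable (borel \<Otimes>\<^sub>M borel)"
    unfolding F_def split_beta by measurable
  have distr: "distr lborel borel (?T t) = lborel" for t
    by (intro lborel_distr_orthogonal orthogonal_weighted_dilation e1)
  have int_T: "integrable lborel (\<lambda>z. f (?T t z))" for t
    using f(3) Tm by (subst (asm) distr[of t, symmetric]) (simp add: integrable_distr_eq)
  have T_inv: "(\<integral>z. h (?T t z) \<partial>lborel) = (\<integral>z. h z \<partial>lborel)"
    if "h \<in> borel_measurable borel" for t and h :: "complex^'n \<Rightarrow> 'b::{banach, second_countable_topology}"
    using integral_distr[of "?T t" lborel borel h] Tm that by (simp add: distr)
  have "integrable (lborel \<Otimes>\<^sub>M lborel) (case_prod F)"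
  proof (rule lborel_pair.Fubini_integrable)
    have "(\<integral>z. norm (F t z) \<partial>lborel) = indicator {0..1} t *\<^sub>R (\<integral>z. norm (f z) \<partial>lborel)" for t
      by (simp add: F_def T_inv[of "\<lambda>z. norm (f z)"])
    then show "integrable lborel (\<lambda>t. \<integral>z. norm (case (t, z) of (t, z) \<Rightarrow> F t z) \<partial>lborel)"
      by simp
    show "AE t in lborel. integrable lborel (\<lambda>z. case (t, z) of (t, z) \<Rightarrow> F t z)"
      using int_T by (simp add: F_def)
  qed simp
  then have "(\<integral>z. (\<integral>t. F t z \<partial>lborel) \<partial>lborel) = (\<integral>t. (\<integral>z. F t z \<partial>lborel) \<partial>lborel)"
    by (rule lborel_pair.Fubini_integral)
  moreover have "(\<integral>z. F t z \<partial>lborel) = indicator {0..1} t *\<^sub>R (\<integral>z. f z \<partial>lborel)" for t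
    by (simp add: F_def T_inv[of f])
  moreover have "(\<integral>t. F t z \<partial>lborel) = indicator D z *\<^sub>R f 0" for z
  proof (cases "z \<in> D")
    case True
    have hol: "(\<lambda>c. f (weighted_dilation m c z)) holomorphic_on cball 0 1"
      by (rule holomorphic_on_weighted_dilation[OF f(1)]) (simp add: bal[OF True])
    have "continuous_on {0..1} (\<lambda>t. f (?T t z))"
      by (rule continuous_on_compose2[OF holomorphic_on_imp_continuous_on[OF hol] e_cont]) (auto simp: e1)
    then have "set_integrable lborel {0..1} (\<lambda>t. f (?T t z))"
      by (rule borel_integrable_atLeastAtMost')
    then have "(LINT t:{0..1}|lborel. f (?T t z)) = integral {0..1} (\<lambda>t. f (?T t z))"
      by (rule set_borel_integral_eq_integral)
    also have "\<dots> = f (weighted_dilation m 0 z)"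
      using has_integral_circle_mean[OF hol] by (intro integral_unique) (simp add: e_def)
    finally show ?thesis
      using True by (simp add: F_def set_lebesgue_integral_def weighted_dilation_0 m)
  next
    case False
    \<comment> \<open>The inverse of a rotation is a rotation, so points outside \<open>D\<close> stay outside.\<close>
    have "?T t z \<notin> D" for t
      using bal[of "?T t z" "inverse (e t)"] False e1[of t]
      by (auto simp: weighted_dilation_compose norm_inverse e_def)
    then show ?thesis using False f(2) by (simp add: F_def)
  qed
  ultimately show ?thesis
    using D by (simp add: scaleR_conv_of_real)
qed


section \<open>The Bergman space and its projection\<close>

lemma borel_measurable_cnj [measurable (raw)]:
  assumes "f \<in> borel_measurable M"
  shows "(\<lambda>x. cnj (f x)) \<in> borel_measurable M"
  using assms by (rule measurable_compose) (intro borel_measurable_continuous_onI continuous_intros)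

lemma integrable_lebesgue_on_iff_lborel:
  fixes f :: "'a::euclidean_space \<Rightarrow> 'b::{banach, second_countable_topology}"
  assumes [measurable]: "D \<in> sets borel" "f \<in> borel_measurable borel" and "\<And>z. z \<notin> D \<Longrightarrow> f z = 0"
  shows "integrable (lebesgue_on D) f \<longleftrightarrow> integrable lborel f"
proof -
  have "(\<lambda>z. indicator D z *\<^sub>R f z) = f" using assms(3) by (auto simp: indicator_def)
  then show ?thesis by (simp add: integrable_restrict_space integrable_completion)
qed

lemma integral_lebesgue_on_eq_lborel:
  fixes f :: "'a::euclidean_space \<Rightarrow> 'b::{banach, second_countable_topology}"
  assumes [measurable]: "D \<in> sets borel" "f \<in> borel_measurable borel" and "\<And>z. z \<notin> D \<Longrightarrow> f z = 0"
  shows "(LINT z|lebesgue_on D. f z) = (LINT z|lborel. f z)"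
proof -
  have "(\<lambda>z. indicator D z *\<^sub>R f z) = f" using assms(3) by (auto simp: indicator_def)
  then show ?thesis by (simp add: integral_restrict_space integral_completion)
qed

text \<open>Extended by zero, a function that is holomorphic on an open set is Borel measurable on the whole
  space. So integrals over \<open>D\<close> become integrals of Borel functions over the whole space, on which the
  rotations act and to which Fubini's theorem applies.\<close>

lemma bergman_space_iff_lborel:
  assumes "open D"
  shows "f \<in> bergman_space D \<longleftrightarrow> holomorphic_sev_on f D \<and> (\<forall>z. z \<notin> D \<longrightarrow> f z = 0)
    \<and> integrable lborel (\<lambda>z. (cmod (f z))\<^sup>2)"
proof (cases "holomorphic_sev_on f D \<and> (\<forall>z. z \<notin> D \<longrightarrow> f z = 0)")
  case True
  then have m[measurable]: "f \<in> borel_measurable borel"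
    using holomorphic_sev_imp_borel[OF assms] by blast
  have "f \<in> borel_measurable (lebesgue_on D)"
    by (intro measurable_restrict_space1 measurable_completion) simp
  then show ?thesis
    using True assms integrable_lebesgue_on_iff_lborel[of D "\<lambda>z. (cmod (f z))\<^sup>2"]
    by (auto simp: bergman_space_def square_integrable_on_def)
qed (auto simp: bergman_space_def)

lemma bergman_space_borel: "open D \<Longrightarrow> f \<in> bergman_space D \<Longrightarrow> f \<in> borel_measurable borel"
  using holomorphic_sev_imp_borel by (auto simp: bergman_space_iff_lborel)

lemma integrable_mult_square_integrable:
  fixes f g :: "'a \<Rightarrow> complex"
  assumes [measurable]: "f \<in> borel_measurable M" "g \<in> borel_measurable M"
    and "integrable M (\<lambda>z. (cmod (f z))\<^sup>2)" "integrable M (\<lambda>z. (cmod (g z))\<^sup>2)"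
  shows "integrable M (\<lambda>z. f z * g z)"
proof (rule Bochner_Integration.integrable_bound)
  show "integrable M (\<lambda>z. (cmod (f z))\<^sup>2 + (cmod (g z))\<^sup>2)" using assms by simp
  have "a * b \<le> a\<^sup>2 + b\<^sup>2" if "a \<ge> 0" "b \<ge> 0" for a b :: real
    using sum_squares_bound[of a b] mult_nonneg_nonneg[OF that] by linarith
  then show "AE z in M. norm (f z * g z) \<le> norm ((cmod (f z))\<^sup>2 + (cmod (g z))\<^sup>2)"
    by (simp add: norm_mult)
qed simp

lemma bergman_space_diff:
  assumes D: "open D" and f: "f \<in> bergman_space D" and g: "g \<in> bergman_space D"
  shows "(\<lambda>z. f z - g z) \<in> bergman_space D"
proof -
  have [measurable]: "f \<in> borel_measurable borel" "g \<in> borel_measurable borel"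
    using bergman_space_borel D f g by auto
  have "integrable lborel (\<lambda>z. (cmod (f z - g z))\<^sup>2)"
  proof (rule Bochner_Integration.integrable_bound)
    show "integrable lborel (\<lambda>z. 2 * (cmod (f z))\<^sup>2 + 2 * (cmod (g z))\<^sup>2)"
      using f g by (simp add: bergman_space_iff_lborel[OF D])
    have "(cmod (a - b))\<^sup>2 \<le> 2 * (cmod a)\<^sup>2 + 2 * (cmod b)\<^sup>2" for a b
    proof -
      have "(cmod (a - b))\<^sup>2 \<le> (cmod a + cmod b)\<^sup>2"
        by (intro power_mono norm_triangle_ineq4) simp
      then show ?thesis using sum_squares_bound[of "cmod a" "cmod b"] by (simp add: power2_sum)
    qed
    then show "AE z in lborel. norm ((cmod (f z - g z))\<^sup>2) \<le> norm (2 * (cmod (f z))\<^sup>2 + 2 * (cmod (g z))\<^sup>2)"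
      by simp
  qed simp
  then show ?thesis using f g by (simp add: bergman_space_iff_lborel[OF D] holomorphic_sev_on_diff)
qed

lemma L2_inner_bergman_space:
  assumes D: "open D" and f: "f \<in> borel_measurable borel" and h: "h \<in> bergman_space D"
  shows "L2_inner D f h = (LINT z|lborel. f z * cnj (h z))"
proof -
  have [measurable]: "h \<in> borel_measurable borel" using bergman_space_borel D h by auto
  show ?thesis unfolding L2_inner_def
    using D f h by (intro integral_lebesgue_on_eq_lborel) (auto simp: bergman_space_def[of D])
qed

text \<open>A vanishing norm gives \<open>f = 0\<close> only almost everywhere. But the set where the continuous function
  \<open>f\<close> is nonzero is open in \<open>D\<close>, and a nonempty open set is not a null set.\<close>

lemma bergman_space_eq_zero:
  assumes D: "open D" and f: "f \<in> bergman_space D" and 0: "L2_inner D f f = 0"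
  shows "f z = 0"
proof (rule ccontr)
  assume nz: "f z \<noteq> 0"
  then have z: "z \<in> D" using f by (auto simp: bergman_space_def)
  have [measurable]: "f \<in> borel_measurable borel" using bergman_space_borel D f by auto
  have hol: "holomorphic_sev_on f D" and int: "integrable lborel (\<lambda>z. (cmod (f z))\<^sup>2)"
    using f D by (auto simp: bergman_space_iff_lborel)
  have "complex_of_real (\<integral>z. (cmod (f z))\<^sup>2 \<partial>lborel) = L2_inner D f f"
    by (simp add: L2_inner_bergman_space[OF D _ f] complex_norm_square flip: integral_complex_of_real of_real_power)
  then have "(\<integral>z. (cmod (f z))\<^sup>2 \<partial>lborel) = 0" using 0 by simp
  then have "AE z in lborel. f z = 0"
    using integral_nonneg_eq_0_iff_AE[OF int] by simp
  then have "AE z in lebesgue. f z = 0" by (rule AE_completion)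
  then have "negligible {z. f z \<noteq> 0}"
    unfolding eventually_ae_filter
    using negligible_subset by (auto simp: negligible_iff_null_sets)
  moreover have "open (D \<inter> f -` (- {0}))"
    using holomorphic_sev_imp_continuous_on[OF hol] D
    by (intro continuous_open_preimage) auto
  moreover have "z \<in> D \<inter> f -` (- {0})" using z nz by simp
  ultimately show False
    using open_not_negligible[of "D \<inter> f -` (- {0})"] negligible_subset[of "{z. f z \<noteq> 0}" "D \<inter> f -` (- {0})"]
    by auto
qed

text \<open>Existence of a projection is not an issue here, since the candidate \<open>g\<close> is given. Uniqueness: the
  difference of two candidates lies in the Bergman space and is orthogonal to it, hence to itself.\<close>

lemma bergman_projection_eqI:
  assumes D: "open D" and g: "g \<in> bergman_space D"
    and f: "f \<in> borel_measurable borel" "integrable lborel (\<lambda>z. (cmod (f z))\<^sup>2)"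
    and orth: "\<And>h. h \<in> bergman_space D \<Longrightarrow> L2_inner D (\<lambda>z. f z - g z) h = 0"
  shows "bergman_projection D f = g"
  unfolding bergman_projection_def
proof (rule the_equality)
  show "g \<in> bergman_space D \<and> (\<forall>h\<in>bergman_space D. L2_inner D (\<lambda>z. f z - g z) h = 0)"
    using g orth by simp
next
  fix g' assume "g' \<in> bergman_space D \<and> (\<forall>h\<in>bergman_space D. L2_inner D (\<lambda>z. f z - g' z) h = 0)"
  then have g': "g' \<in> bergman_space D" and orth': "\<And>h. h \<in> bergman_space D \<Longrightarrow> L2_inner D (\<lambda>z. f z - g' z) h = 0"
    by auto
  note [measurable] = bergman_space_borel[OF D g] bergman_space_borel[OF D g'] f(1)
  let ?d = "\<lambda>z. g' z - g z"
  have d: "?d \<in> bergman_space D" by (rule bergman_space_diff[OF D g' g])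
  have int: "integrable lborel (\<lambda>z. u z * cnj (?d z))"
    if "u \<in> borel_measurable borel" "integrable lborel (\<lambda>z. (cmod (u z))\<^sup>2)" for u
    using that d D
    by (intro integrable_mult_square_integrable) (auto simp: bergman_space_iff_lborel simp del: complex_cnj_diff)
  have L2: "integrable lborel (\<lambda>z. (cmod (g z))\<^sup>2)" "integrable lborel (\<lambda>z. (cmod (g' z))\<^sup>2)"
    using g g' D by (auto simp: bergman_space_iff_lborel)
  have "L2_inner D ?d ?d = L2_inner D (\<lambda>z. f z - g z) ?d - L2_inner D (\<lambda>z. f z - g' z) ?d"
    using int[OF f] int[of g] int[of g'] L2
    by (simp add: L2_inner_bergman_space[OF D _ d] left_diff_distrib Bochner_Integration.integral_diff
        del: complex_cnj_diff)
  then have "L2_inner D ?d ?d = 0" using orth[OF d] orth'[OF d] by simp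
  from bergman_space_eq_zero[OF D d this] show "g' = g" by (simp add: fun_eq_iff)
qed

lemma const_in_bergman_space:
  assumes "open D" "emeasure lborel D < \<infinity>"
  shows "(\<lambda>z. if z \<in> D then k else 0) \<in> bergman_space D"
proof -
  have "(\<lambda>z. (cmod (if z \<in> D then k else 0))\<^sup>2) = (\<lambda>z. indicator D z *\<^sub>R (cmod k)\<^sup>2)"
    by (auto simp: indicator_def)
  moreover have "integrable lborel (\<lambda>z. indicator D z *\<^sub>R (cmod k)\<^sup>2)"
    using assms by (intro integrable_scaleR_left) (simp_all add: integrable_indicator_iff)
  ultimately show ?thesis
    using assms holomorphic_sev_on_const_indicator by (simp add: bergman_space_iff_lborel)
qed

section \<open>The Friedrichs operator of a quasi-balanced domain\<close>

text \<open>The integrand \<open>cnj (g z - g 0) * cnj (h z)\<close> of the inner product in question is the conjugate of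
  a holomorphic function that vanishes at the origin, so its integral over \<open>D\<close> is zero.\<close>

lemma friedrichs_quasi_balanced:
  fixes D :: "(complex^'n) set"
  assumes D: "open D" "emeasure lborel D < \<infinity>"
    and bal: "\<And>c z. z \<in> D \<Longrightarrow> cmod c \<le> 1 \<Longrightarrow> weighted_dilation m c z \<in> D"
    and m: "\<And>i. m i > 0"
    and g: "g \<in> bergman_space D"
  shows "friedrichs D g = (\<lambda>z. if z \<in> D then cnj (g 0) else 0)"
  unfolding friedrichs_def
proof (rule bergman_projection_eqI)
  note [measurable] = bergman_space_borel[OF D(1) g]
  show "(\<lambda>z. cnj (g z)) \<in> borel_measurable borel" by measurable
  show "integrable lborel (\<lambda>z. (cmod (cnj (g z)))\<^sup>2)"
    using g D by (simp add: bergman_space_iff_lborel)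
  fix h assume h: "h \<in> bergman_space D"
  note [measurable] = bergman_space_borel[OF D(1) h]
  have integrable_mult: "integrable lborel (\<lambda>z. u z * h z)" if "u \<in> bergman_space D" for u
    using that h D(1) bergman_space_borel[OF D(1)]
    by (intro integrable_mult_square_integrable) (auto simp: bergman_space_iff_lborel)
  have mean: "(\<integral>z. u z * h z \<partial>lborel) = measure lborel D * (u 0 * h 0)" if u: "u \<in> bergman_space D" for u
    using u h D(1)
    by (intro integral_holomorphic_quasi_balanced[OF D bal m] integrable_mult holomorphic_sev_on_mult)
       (auto simp: bergman_space_def)
  let ?k = "\<lambda>z. if z \<in> D then g 0 else 0"
  have k: "?k \<in> bergman_space D" using const_in_bergman_space D by blast
  note [measurable] = bergman_space_borel[OF D(1) k]
  have h0: "0 \<notin> D \<Longrightarrow> h 0 = 0" using h by (auto simp: bergman_space_def)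
  have "L2_inner D (\<lambda>z. cnj (g z) - (if z \<in> D then cnj (g 0) else 0)) h
     = L2_inner D (\<lambda>z. cnj (g z - ?k z)) h"
    by (intro arg_cong2[where f="L2_inner D"]) auto
  also have "\<dots> = (\<integral>z. cnj (g z * h z - ?k z * h z) \<partial>lborel)"
    by (subst L2_inner_bergman_space[OF D(1) _ h]) (auto simp: algebra_simps intro!: Bochner_Integration.integral_cong)
  also have "\<dots> = cnj ((\<integral>z. g z * h z \<partial>lborel) - (\<integral>z. ?k z * h z \<partial>lborel))"
    by (subst Bochner_Integration.integral_diff[symmetric, OF integrable_mult[OF g] integrable_mult[OF k]])
       (rule Bochner_Integration.integral_cnj)
  also have "\<dots> = 0" using mean[OF g] mean[OF k] h0 by (simp del: complex_cnj_diff)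
  finally show "L2_inner D (\<lambda>z. cnj (g z) - (if z \<in> D then cnj (g 0) else 0)) h = 0" .
qed (use D const_in_bergman_space in blast)+

theorem friedrichs_rank_one_quasi_balanced:
  fixes D :: "(complex^'n) set"
  assumes D: "open D" "D \<noteq> {}" "emeasure lborel D < \<infinity>"
    and bal: "\<And>c z. z \<in> D \<Longrightarrow> cmod c \<le> 1 \<Longrightarrow> weighted_dilation m c z \<in> D"
    and m: "\<And>i. m i > 0"
  shows "friedrichs_rank_one D"
proof -
  define one :: "complex^'n \<Rightarrow> complex" where "one z = (if z \<in> D then 1 else 0)" for z
  have scale: "cfun_scale k one = (\<lambda>z. if z \<in> D then k else 0)" for k
    by (auto simp: cfun_scale_def one_def)
  obtain w where "w \<in> D" using D by blast
  then have "0 \<in> D" using bal[of w 0] by (simp add: weighted_dilation_0 m)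
  have "friedrichs D ` bergman_space D = range (\<lambda>k. cfun_scale k one)"
  proof (intro equalityI subsetI)
    fix f assume "f \<in> range (\<lambda>k. cfun_scale k one)"
    then obtain k where k: "f = cfun_scale k one" by blast
    have const: "cfun_scale (cnj k) one \<in> bergman_space D"
      unfolding scale by (rule const_in_bergman_space[OF D(1,3)])
    have "friedrichs D (cfun_scale (cnj k) one) = cfun_scale (cnj (cfun_scale (cnj k) one 0)) one"
      unfolding scale[of "cnj (cfun_scale (cnj k) one 0)"]
      by (rule friedrichs_quasi_balanced[OF D(1,3) bal m const])
    also have "cnj (cfun_scale (cnj k) one 0) = k"
      using \<open>0 \<in> D\<close> by (simp add: scale)
    finally have "f = friedrichs D (cfun_scale (cnj k) one)" by (simp only: k)
    then show "f \<in> friedrichs D ` bergman_space D" using const by (rule image_eqI)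
  next
    fix f assume "f \<in> friedrichs D ` bergman_space D"
    then obtain g where g: "g \<in> bergman_space D" and f: "f = friedrichs D g" by blast
    have "f = cfun_scale (cnj (g 0)) one"
      unfolding f scale by (rule friedrichs_quasi_balanced[OF D(1,3) bal m g])
    then show "f \<in> range (\<lambda>k. cfun_scale k one)" by (rule range_eqI)
  qed
  also have "\<dots> = cfun.span {one}" by (simp add: cfun.span_singleton)
  finally have range: "friedrichs D ` bergman_space D = cfun.span {one}" .
  have "one w \<noteq> 0" using \<open>w \<in> D\<close> by (simp add: one_def)
  then have "one \<noteq> 0" by (metis zero_fun_def)
  then have "cfun.dim (cfun.span {one}) = 1"
    by (simp add: cfun.dim_eq_card_independent)
  then show ?thesis
    unfolding friedrichs_rank_one_def range by (simp add: cfun.subspace_span)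
qed

section \<open>The operator norm and the entries of a matrix\<close>

lemma bounded_linear_matrix_vector_mult:
  "bounded_linear (\<lambda>v. (A :: complex^'n^'m) *v v)"
proof -
  have "linear (\<lambda>v. A *v v)"
    by (rule linearI)
       (simp_all add: matrix_vector_right_distrib matrix_vector_mult_def vec_eq_iff scaleR_sum_right
         distrib_left sum.distrib)
  then show ?thesis by (simp add: linear_conv_bounded_linear)
qed

lemma cmod_entry_le_onorm:
  "cmod ((A :: complex^'n^'m) $ i $ j) \<le> onorm (\<lambda>v. A *v v)"
proof -
  have "(A *v axis j 1) $ i = A $ i $ j"
    by (simp add: matrix_vector_mult_def axis_def if_distrib cong: if_cong)
  then have "cmod (A $ i $ j) \<le> norm (A *v axis j 1)"
    using Finite_Cartesian_Product.norm_nth_le[of "A *v axis j 1" i] by simp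
  also have "\<dots> \<le> onorm (\<lambda>v. A *v v)"
    using onorm[OF bounded_linear_matrix_vector_mult, of A "axis j 1"] by (simp add: norm_axis_1)
  finally show ?thesis .
qed

lemma onorm_le_sum_cmod:
  "onorm (\<lambda>v. (A :: complex^'n^'m) *v v) \<le> (\<Sum>i\<in>UNIV. \<Sum>j\<in>UNIV. cmod (A $ i $ j))"
proof (rule onorm_le)
  fix v :: "complex^'n"
  have "norm (A *v v) \<le> (\<Sum>i\<in>UNIV. cmod ((A *v v) $ i))"
    by (simp add: norm_vec_def L2_set_le_sum)
  also have "\<dots> \<le> (\<Sum>i\<in>UNIV. \<Sum>j\<in>UNIV. cmod (A $ i $ j) * norm v)"
    unfolding matrix_vector_mult_def
    by (intro sum_mono) (auto intro!: sum_norm_le mult_left_mono simp: norm_mult Finite_Cartesian_Product.norm_nth_le)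
  finally show "norm (A *v v) \<le> (\<Sum>i\<in>UNIV. \<Sum>j\<in>UNIV. cmod (A $ i $ j)) * norm v"
    by (simp add: sum_distrib_right)
qed

lemma onorm_matrix_diff_less:
  fixes A B :: "complex^'n^'m"
  assumes "(\<Sum>i\<in>UNIV. \<Sum>j\<in>UNIV. cmod (B $ i $ j - A $ i $ j)) < r - onorm (\<lambda>v. A *v v)"
  shows "onorm (\<lambda>v. B *v v) < r"
proof -
  have "onorm (\<lambda>v. B *v v) = onorm (\<lambda>v. A *v v + (B - A) *v v)"
    by (simp flip: matrix_vector_mult_add_rdistrib)
  also have "\<dots> \<le> onorm (\<lambda>v. A *v v) + onorm (\<lambda>v. (B - A) *v v)"
    by (intro onorm_triangle bounded_linear_matrix_vector_mult)
  also have "\<dots> < r" using onorm_le_sum_cmod[of "B - A"] assms by simp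
  finally show ?thesis .
qed

section \<open>The pentablock\<close>

lemma mem_pentablock_iff:
  "z \<in> pentablock \<longleftrightarrow> (\<exists>A :: complex^2^2. onorm (\<lambda>v. A *v v) < 1 \<and> z $ 1 = A $ 2 $ 1
     \<and> z $ 2 = A $ 1 $ 1 + A $ 2 $ 2 \<and> z $ 3 = A $ 1 $ 1 * A $ 2 $ 2 - A $ 1 $ 2 * A $ 2 $ 1)"
  by (auto simp: pentablock_def vec_eq_iff forall_3 det_2 trace_def sum_2 vector_3)

lemma monic_quadratic_roots:
  fixes s q :: complex
  obtains x y where "x + y = s" "x * y = q"
proof
  let ?d = "csqrt (s\<^sup>2 - 4 * q)"
  show "(s + ?d) / 2 + (s - ?d) / 2 = s" by (simp add: field_simps)
  have "(s + ?d) * (s - ?d) = s\<^sup>2 - ?d\<^sup>2" by (simp add: algebra_simps power2_eq_square)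
  then show "(s + ?d) / 2 * ((s - ?d) / 2) = q" by simp
qed

text \<open>Continuity of roots: if \<open>a\<close> is almost a root of \<open>t\<^sup>2 - s t + q = (t - x) (t - y)\<close>, then the product
  \<open>(a - x) (a - y)\<close> is small, so one of its factors is.\<close>

lemma monic_quadratic_root_near:
  fixes s q a :: complex
  assumes "cmod (q - s * a + a\<^sup>2) < e\<^sup>2" "e > 0"
  obtains x y where "x + y = s" "x * y = q" "cmod (x - a) < e"
proof -
  obtain x y where xy: "x + y = s" "x * y = q" by (rule monic_quadratic_roots)
  have "(x - a) * (y - a) = q - s * a + a\<^sup>2"
    by (simp add: algebra_simps power2_eq_square flip: xy)
  then have "cmod (x - a) * cmod (y - a) < e * e"
    using assms by (simp add: power2_eq_square flip: norm_mult)
  then have "cmod (x - a) < e \<or> cmod (y - a) < e"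
    using mult_mono[of e "cmod (x - a)" e "cmod (y - a)"] \<open>e > 0\<close> by force
  then show thesis using that[of x y] that[of y x] xy by (auto simp: ac_simps)
qed

text \<open>Given a matrix \<open>A\<close> over a point, every nearby point \<open>z\<close> has to be lifted to a matrix near \<open>A\<close>. The
  entry \<open>a\<^sub>2\<^sub>1\<close> must be \<open>z\<^sub>1\<close>, and \<open>a\<^sub>1\<^sub>2\<close> can be kept. Then the diagonal entries must have sum \<open>z\<^sub>2\<close> and
  product \<open>z\<^sub>3 + a\<^sub>1\<^sub>2 z\<^sub>1\<close>, so they are the roots of a monic quadratic whose coefficients depend
  continuously on \<open>z\<close>. This works also where \<open>a\<^sub>2\<^sub>1 = 0\<close>, where solving the equation of the determinant
  for \<open>a\<^sub>1\<^sub>2\<close> would fail.\<close>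

lemma open_pentablock: "open pentablock"
proof (subst open_subopen, intro ballI)
  fix z0 assume "z0 \<in> pentablock"
  then obtain A :: "complex^2^2" where A: "onorm (\<lambda>v. A *v v) < 1"
    and z0: "z0 $ 1 = A $ 2 $ 1" "z0 $ 2 = A $ 1 $ 1 + A $ 2 $ 2"
      "z0 $ 3 = A $ 1 $ 1 * A $ 2 $ 2 - A $ 1 $ 2 * A $ 2 $ 1"
    unfolding mem_pentablock_iff by blast
  \<comment> \<open>The lift will differ from \<open>A\<close> by less than \<open>e\<close>, \<open>0\<close>, \<open>e\<close> and \<open>2 * e\<close> in its four entries,
    hence by less than \<open>5 * e\<close> in operator norm.\<close>
  define e where "e = (1 - onorm (\<lambda>v. A *v v)) / 5"
  have e: "e > 0" using A by (simp add: e_def)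
  define T where "T = {z :: complex^3. cmod (z $ 1 - A $ 2 $ 1) < e \<and> cmod (z $ 2 - (A $ 1 $ 1 + A $ 2 $ 2)) < e
    \<and> cmod (z $ 3 + A $ 1 $ 2 * z $ 1 - z $ 2 * A $ 1 $ 1 + (A $ 1 $ 1)\<^sup>2) < e\<^sup>2}"
  have "open T"
    unfolding T_def by (intro open_Collect_conj open_Collect_less continuous_intros)
  moreover have "z0 \<in> T"
    using e by (simp add: T_def z0 algebra_simps power2_eq_square)
  moreover have "T \<subseteq> pentablock"
  proof
    fix z assume "z \<in> T"
    then have z: "cmod (z $ 1 - A $ 2 $ 1) < e" "cmod (z $ 2 - (A $ 1 $ 1 + A $ 2 $ 2)) < e"
      "cmod ((z $ 3 + A $ 1 $ 2 * z $ 1) - z $ 2 * A $ 1 $ 1 + (A $ 1 $ 1)\<^sup>2) < e\<^sup>2"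
      by (auto simp: T_def)
    obtain x y where xy: "x + y = z $ 2" "x * y = z $ 3 + A $ 1 $ 2 * z $ 1" "cmod (x - A $ 1 $ 1) < e"
      using monic_quadratic_root_near[OF z(3) e] by blast
    have y_eq: "y - A $ 2 $ 2 = (z $ 2 - (A $ 1 $ 1 + A $ 2 $ 2)) - (x - A $ 1 $ 1)"
      by (simp flip: xy(1))
    have y: "cmod (y - A $ 2 $ 2) < 2 * e"
      unfolding y_eq
      using norm_triangle_ineq4[of "z $ 2 - (A $ 1 $ 1 + A $ 2 $ 2)" "x - A $ 1 $ 1"] z(2) xy(3)
      by linarith
    define B :: "complex^2^2" where "B = vector [vector [x, A $ 1 $ 2], vector [z $ 1, y]]"
    have B: "B $ 1 $ 1 = x" "B $ 1 $ 2 = A $ 1 $ 2" "B $ 2 $ 1 = z $ 1" "B $ 2 $ 2 = y"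
      by (simp_all add: B_def)
    have "onorm (\<lambda>v. B *v v) < 1"
      using z(1) xy(3) y e by (intro onorm_matrix_diff_less[of B A]) (simp add: sum_2 B e_def)
    then show "z \<in> pentablock"
      unfolding mem_pentablock_iff using xy by (intro exI[of _ B]) (simp add: B)
  qed
  ultimately show "\<exists>T. open T \<and> z0 \<in> T \<and> T \<subseteq> pentablock" by blast
qed

lemma bounded_pentablock: "bounded pentablock"
proof (rule boundedI)
  fix z assume "z \<in> pentablock"
  then obtain A :: "complex^2^2" where A: "onorm (\<lambda>v. A *v v) < 1"
    and z: "z $ 1 = A $ 2 $ 1" "z $ 2 = A $ 1 $ 1 + A $ 2 $ 2"
      "z $ 3 = A $ 1 $ 1 * A $ 2 $ 2 - A $ 1 $ 2 * A $ 2 $ 1"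
    unfolding mem_pentablock_iff by blast
  have le1: "cmod (A $ i $ j) \<le> 1" for i j
    using cmod_entry_le_onorm[of A i j] A by linarith
  then have le: "cmod (A $ i $ j * A $ k $ l) \<le> 1" for i j k l
    by (simp add: norm_mult mult_le_one)
  have "norm z \<le> cmod (z $ 1) + cmod (z $ 2) + cmod (z $ 3)"
    using L2_set_le_sum[of UNIV "\<lambda>i. cmod (z $ i)"] by (simp add: norm_vec_def sum_3)
  also have "\<dots> \<le> 1 + (1 + 1) + (1 + 1)"
    unfolding z
    by (intro add_mono order.trans[OF norm_triangle_ineq] order.trans[OF norm_triangle_ineq4] le le1)
  finally show "norm z \<le> 5" by simp
qed

text \<open>Scaling \<open>A\<close> by \<open>c\<close> scales \<open>a\<^sub>2\<^sub>1\<close> and the trace by \<open>c\<close> and the determinant by \<open>c\<^sup>2\<close>, whence the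
  weights \<open>(1, 1, 2)\<close>.\<close>

lemma weighted_dilation_pentablock:
  assumes "z \<in> pentablock" "cmod c \<le> 1"
  shows "weighted_dilation (\<lambda>i. if i = 3 then 2 else 1) c z \<in> pentablock"
proof -
  obtain A :: "complex^2^2" where A: "onorm (\<lambda>v. A *v v) < 1"
    and z: "z $ 1 = A $ 2 $ 1" "z $ 2 = A $ 1 $ 1 + A $ 2 $ 2"
      "z $ 3 = A $ 1 $ 1 * A $ 2 $ 2 - A $ 1 $ 2 * A $ 2 $ 1"
    using assms unfolding mem_pentablock_iff by blast
  define B :: "complex^2^2" where "B = (\<chi> i j. c * A $ i $ j)"
  have "onorm (\<lambda>v. B *v v) \<le> onorm (\<lambda>v. A *v v)"
  proof (rule onorm_le)
    fix v
    have "B *v v = c *s (A *v v)"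
      by (simp add: B_def matrix_vector_mult_def vec_eq_iff sum_distrib_left mult.assoc)
    then have "norm (B *v v) = cmod c * norm (A *v v)"
      by (simp add: norm_vec_def norm_mult L2_set_right_distrib)
    also have "\<dots> \<le> norm (A *v v)" using assms by (simp add: mult_left_le_one_le)
    also have "\<dots> \<le> onorm (\<lambda>v. A *v v) * norm v"
      by (rule onorm[OF bounded_linear_matrix_vector_mult])
    finally show "norm (B *v v) \<le> onorm (\<lambda>v. A *v v) * norm v" .
  qed
  then have "onorm (\<lambda>v. B *v v) < 1" using A by linarith
  then show ?thesis
    unfolding mem_pentablock_iff
    by (intro exI[of _ B])
       (simp add: B_def weighted_dilation_def z algebra_simps power2_eq_square)
qed

theorem theorem4p4: "friedrichs_rank_one pentablock"
proof (rule friedrichs_rank_one_quasi_balanced[where m = "\<lambda>i. if i = 3 then 2 else 1"])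
  show "open pentablock" by (rule open_pentablock)
  have "(\<lambda>v. (0 :: complex^2^2) *v v) = (\<lambda>v. 0)"
    by (simp add: fun_eq_iff matrix_vector_mult_def vec_eq_iff)
  then have "onorm (\<lambda>v. (0 :: complex^2^2) *v v) = 0" by (simp only: onorm_zero)
  then have zero: "onorm (\<lambda>v. (0 :: complex^2^2) *v v) < 1" by linarith
  have "0 \<in> pentablock"
    unfolding mem_pentablock_iff by (intro exI[of _ 0] conjI zero) simp_all
  then show "pentablock \<noteq> {}" by blast
  show "emeasure lborel pentablock < \<infinity>"
    using bounded_pentablock by (rule emeasure_bounded_finite)
  show "weighted_dilation (\<lambda>i. if i = 3 then 2 else 1) c z \<in> pentablock"
    if "z \<in> pentablock" "cmod c \<le> 1" for c z
    using that by (rule weighted_dilation_pentablock)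
qed simp

end
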